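(* For each $n\geq3$, $\mathcal{BC}_n$ is the frontier of $\mathcal{C}_n$ in $\mathcal{AC}_n$. It is the orbit of $\mathrm{graph}(b_0)=\{(b_0(\mathbf{d}),\mathbf{d}) : \mathbf{d}\in(0,\infty)^{n-1}\}$ under cyclic permutation of entries, where $b_0\colon(0,\infty)^{n-1}\to\mathbb{R}$ is defined, for $\mathbf{d}=(d_1,\ldots,d_{n-1})$, by $$\sum_{i=1}^{n-1}\theta(d_i,b_0(\mathbf{d})/2)=\pi.$$ This function is symmetric, smooth, and strictly increasing in each variable. It further satisfies $b_0(d_1,\ldots,d_{n-1})>\max\{d_i\}_{i=1}^{n-1}$. In particular, $\mathcal{BC}_n$ has $n$ connected components.
   Context: For $d>0$ and $J\geq d/2$ let $\theta(d,J)=2\sin^{-1}(\sinh(d/2)/\sinh J)\in[0,\pi]$. Define $$\mathcal{AC}_n=\Big\{(d_0,\ldots,d_{n-1})\in(0,\infty)^n : \sinh(d_i/2)<\sum_{j\neq i}\sinh(d_j/2)\text{ for each } i\Big\},$$ $$\mathcal{C}_n=\Big\{(d_0,\ldots,d_{n-1})\in(0,\infty)^n : \sum_{i=0}^{n-1}\theta(d_i,D/2)>2\pi,\ D=\max_i d_i\Big\},$$ $$\mathcal{BC}_n=\Big\{(d_0,\ldots,d_{n-1})\in(0,\infty)^n : \sum_{i=0}^{n-1}\theta(d_i,D/2)=2\pi,\ D=\max_i d_i\Big\}.$$ Both $\mathcal{C}_n$ and $\mathcal{BC}_n$ are subsets of $\mathcal{AC}_n$. The frontier of a subset of a topological space is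 its closure minus its interior. A function is symmetric if it is invariant under all permutations of its arguments. *)

theory Defs
  imports "HOL-Analysis.Analysis"
begin

text \<open>
  A tuple in \<open>\<real>\<^sup>n\<close> is a point of \<^const>\<open>Euclidean_space\<close> \<open>n\<close>: a function
  \<open>nat \<Rightarrow> real\<close> with entries at the indices \<open>0, \<dots>, n - 1\<close>, and the value \<open>0\<close> elsewhere.
\<close>

definition pos_orthant :: "nat \<Rightarrow> (nat \<Rightarrow> real) set" where
  "pos_orthant n = {d \<in> topspace (Euclidean_space n). \<forall>i<n. 0 < d i}"

text \<open>Only meaningful for \<open>0 < d\<close> and \<open>d / 2 \<le> J\<close>; otherwise \<^const>\<open>arcsin\<close> may be
  applied outside of \<open>[-1, 1]\<close>, where its value is unspecified.\<close>

definition theta :: "real \<Rightarrow> real \<Rightarrow> real" where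
  "theta d J = 2 * arcsin (sinh (d / 2) / sinh J)"

definition AC_set :: "nat \<Rightarrow> (nat \<Rightarrow> real) set" where
  "AC_set n = {d \<in> pos_orthant n.
     \<forall>i<n. sinh (d i / 2) < (\<Sum>j\<in>{..<n} - {i}. sinh (d j / 2))}"

definition C_set :: "nat \<Rightarrow> (nat \<Rightarrow> real) set" where
  "C_set n = {d \<in> pos_orthant n. (\<Sum>i<n. theta (d i) (Max (d ` {..<n}) / 2)) > 2 * pi}"

definition BC_set :: "nat \<Rightarrow> (nat \<Rightarrow> real) set" where
  "BC_set n = {d \<in> pos_orthant n. (\<Sum>i<n. theta (d i) (Max (d ` {..<n}) / 2)) = 2 * pi}"

text \<open>The defining equation of \<open>b\<^sub>0(d)\<close> for a tuple \<open>d\<close> with \<open>m\<close> entries. The first conjunct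
  says that every \<open>theta (d i) (b / 2)\<close> is taken within the domain of \<^const>\<open>theta\<close>.\<close>

definition b0_equation :: "nat \<Rightarrow> (nat \<Rightarrow> real) \<Rightarrow> real \<Rightarrow> bool" where
  "b0_equation m d b \<longleftrightarrow> (\<forall>i<m. d i / 2 \<le> b / 2) \<and> (\<Sum>i<m. theta (d i) (b / 2)) = pi"

definition b0 :: "nat \<Rightarrow> (nat \<Rightarrow> real) \<Rightarrow> real" where
  "b0 m d = (THE b. b0_equation m d b)"

text \<open>The tuple \<open>(b\<^sub>0(d), d)\<close> puts \<open>b\<^sub>0(d)\<close> at index \<open>0\<close> and shifts the entries of \<open>d\<close> by one.\<close>

definition graph_b0 :: "nat \<Rightarrow> (nat \<Rightarrow> real) set" where
  "graph_b0 m = {case_nat (b0 m d) d |d. d \<in> pos_orthant m}"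

definition cyclic_shift :: "nat \<Rightarrow> nat \<Rightarrow> (nat \<Rightarrow> real) \<Rightarrow> (nat \<Rightarrow> real)" where
  "cyclic_shift n k d = (\<lambda>i. if i < n then d ((i + k) mod n) else 0)"

definition cyclic_orbit :: "nat \<Rightarrow> (nat \<Rightarrow> real) set \<Rightarrow> (nat \<Rightarrow> real) set" where
  "cyclic_orbit n S = (\<Union>k<n. cyclic_shift n k ` S)"

text \<open>
  \<open>C_k_on m S k f\<close>: on the open subset \<open>S\<close> of \<open>\<real>\<^sup>m\<close>, all iterated partial derivatives of \<open>f\<close>
  of order \<open>k\<close> (in every sequence of coordinate directions) exist and are continuous.
\<close>

primrec C_k_on :: "nat \<Rightarrow> (nat \<Rightarrow> real) set \<Rightarrow> nat \<Rightarrow> ((nat \<Rightarrow> real) \<Rightarrow> real) \<Rightarrow> bool" where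
  "C_k_on m S 0 f \<longleftrightarrow> continuous_map (subtopology (Euclidean_space m) S) euclideanreal f"
| "C_k_on m S (Suc k) f \<longleftrightarrow>
     (\<forall>i<m. \<exists>g. (\<forall>d\<in>S. ((\<lambda>t. f (d(i := t))) has_real_derivative g d) (at (d i))) \<and>
                C_k_on m S k g)"

definition smooth_on :: "nat \<Rightarrow> (nat \<Rightarrow> real) set \<Rightarrow> ((nat \<Rightarrow> real) \<Rightarrow> real) \<Rightarrow> bool" where
  "smooth_on m S f \<longleftrightarrow> (\<forall>k. C_k_on m S k f)"

definition symmetric_on :: "nat \<Rightarrow> (nat \<Rightarrow> real) set \<Rightarrow> ((nat \<Rightarrow> real) \<Rightarrow> real) \<Rightarrow> bool" where
  "symmetric_on m S f \<longleftrightarrow> (\<forall>p. p permutes {..<m} \<longrightarrow> (\<forall>d\<in>S. f (d \<circ> p) = f d))"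

definition strict_mono_in_each_variable_on ::
  "nat \<Rightarrow> (nat \<Rightarrow> real) set \<Rightarrow> ((nat \<Rightarrow> real) \<Rightarrow> real) \<Rightarrow> bool" where
  "strict_mono_in_each_variable_on m S f \<longleftrightarrow>
     (\<forall>i<m. \<forall>d\<in>S. \<forall>t. d(i := t) \<in> S \<longrightarrow> d i < t \<longrightarrow> f d < f (d(i := t)))"

end

theory Submission
  imports Defs
begin

text \<open>
  For fixed \<open>d\<close>, the sum \<open>\<Sum>i<m. theta (d i) (b / 2)\<close> is strictly decreasing in \<open>b\<close>; it exceeds \<open>\<pi>\<close>
  at \<open>b = max d\<close> and tends to \<open>0\<close>, so \<open>b\<^sub>0\<close> exists, and comparing a number with \<open>b\<^sub>0(d)\<close> amounts to
  comparing the sum with \<open>\<pi>\<close>. This yields continuity and monotonicity. On \<open>BC_set n\<close> the maximal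
  entry contributes \<open>\<pi>\<close> to the total angle, so the remaining entries satisfy the equation of \<open>b\<^sub>0\<close>
  and the maximum is attained only once. Its position splits \<open>BC_set n\<close> into \<open>n\<close> clopen pieces,
  each a rotated graph of \<open>b\<^sub>0\<close> over a connected set.
\<close>

subsection \<open>Existence, continuity and monotonicity of \<open>b\<^sub>0\<close>\<close>

lemma topspace_Euclidean_space_iff:
  "d \<in> topspace (Euclidean_space n) \<longleftrightarrow> (\<forall>i\<ge>n. d i = 0)"
  by (simp add: topspace_Euclidean_space)

text \<open>Reduces the abstract topologies of the statement to \<open>top_of_set\<close> on a
  function type, where \<open>continuous_on\<close> and \<open>connected\<close> apply.\<close>

lemma subtopology_Euclidean_space:
  assumes "S \<subseteq> topspace (Euclidean_space n)"
  shows "subtopology (Euclidean_space n) S = top_of_set S"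
proof -
  have "Euclidean_space n = top_of_set (topspace (Euclidean_space n))"
    by (simp add: Euclidean_space_def euclidean_product_topology)
  then show ?thesis
    using assms by (metis inf.absorb_iff2 subtopology_subtopology)
qed

section \<open>The angle function \<open>theta\<close>\<close>

lemma sinh_ratio_bounds:
  fixes d J :: real
  assumes "0 < d" "d / 2 \<le> J"
  shows "0 < sinh (d / 2) / sinh J" "sinh (d / 2) / sinh J \<le> 1"
proof -
  have "0 < sinh (d / 2)" "sinh (d / 2) \<le> sinh J" using assms by simp_all
  then show "0 < sinh (d / 2) / sinh J" "sinh (d / 2) / sinh J \<le> 1" by auto
qed

lemma theta_pos:
  assumes "0 < d" "d / 2 \<le> J"
  shows "0 < theta d J"
  using sinh_ratio_bounds[OF assms] arcsin_less_mono[of 0 "sinh (d / 2) / sinh J"]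
  by (simp add: theta_def)

lemma theta_self: "0 < d \<Longrightarrow> theta d (d / 2) = pi"
  by (simp add: theta_def)

lemma theta_strict_mono:
  assumes "0 < d" "d < e" "e / 2 \<le> J"
  shows "theta d J < theta e J"
proof -
  have "sinh (d / 2) / sinh J < sinh (e / 2) / sinh J"
    using assms by (intro divide_strict_right_mono) auto
  then show ?thesis
    using sinh_ratio_bounds[of d J] sinh_ratio_bounds[of e J] assms
    by (simp add: theta_def arcsin_less_mono)
qed

lemma theta_strict_antimono:
  assumes "0 < d" "d / 2 \<le> J" "J < K"
  shows "theta d K < theta d J"
proof -
  have "sinh (d / 2) / sinh K < sinh (d / 2) / sinh J"
    using assms by (intro divide_strict_left_mono mult_pos_pos) auto
  then show ?thesis
    using sinh_ratio_bounds[of d J] sinh_ratio_bounds[of d K] assms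
    by (simp add: theta_def arcsin_less_mono)
qed

text \<open>The boundary case \<open>f x / 2 = g x\<close> is included, since \<open>arcsin\<close>
  is continuous on the closed interval; it occurs at maximal entries.\<close>

lemma continuous_on_theta [continuous_intros]:
  assumes "continuous_on S f" "continuous_on S g" "\<And>x. x \<in> S \<Longrightarrow> 0 < f x \<and> f x / 2 \<le> g x"
  shows "continuous_on S (\<lambda>x. theta (f x) (g x))"
proof -
  show ?thesis
    unfolding theta_def
  proof (intro continuous_intros assms ballI conjI)
    fix x assume "x \<in> S"
    then show "(2::real) \<noteq> 0" "- 1 \<le> sinh (f x / 2) / sinh (g x)" "sinh (f x / 2) / sinh (g x) \<le> 1" "sinh (g x) \<noteq> 0"
      using sinh_ratio_bounds[of "f x" "g x"] assms(3)[of x] by (simp, linarith, linarith, auto)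
  qed
qed

text \<open>The strict bound puts the ratio at \<open>a\<close> inside the open interval (-1, 1), so
  the nearby values \<open>f x\<close> need no domain condition.\<close>

lemma tendsto_theta:
  assumes "(f \<longlongrightarrow> a) F" "0 < a" "a / 2 < J"
  shows "((\<lambda>x. theta (f x) J) \<longlongrightarrow> theta a J) F"
proof -
  have "isCont (\<lambda>t. theta t J) a"
    unfolding theta_def
  proof (intro continuous_intros isCont_o2[OF _ isCont_arcsin])
    show "(2::real) \<noteq> 0" by simp
    have "0 < sinh (a / 2)" "sinh (a / 2) < sinh J" using assms by simp_all
    then show "- 1 < sinh (a / 2) / sinh J" "sinh (a / 2) / sinh J < 1" "sinh J \<noteq> 0"
      by (auto intro: less_trans[of _ 0])
  qed
  then show ?thesis using assms(1) by (rule isCont_tendsto_compose)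
qed

lemma theta_tendsto_0: "(theta d \<longlongrightarrow> 0) at_top"
proof -
  have "((\<lambda>J. sinh (d / 2) / sinh J) \<longlongrightarrow> 0) at_top"
    by (rule tendsto_divide_0[OF tendsto_const filterlim_at_top_imp_at_infinity[OF sinh_real_at_top]])
  then have "((\<lambda>J. 2 * arcsin (sinh (d / 2) / sinh J)) \<longlongrightarrow> 2 * arcsin 0) at_top"
    by (intro tendsto_intros isCont_tendsto_compose[OF isCont_arcsin]) auto
  then show ?thesis by (simp add: theta_def[abs_def])
qed

section \<open>The positive orthant\<close>

lemma pos_orthantD:
  assumes "d \<in> pos_orthant m"
  shows "i < m \<Longrightarrow> 0 < d i" "i \<ge> m \<Longrightarrow> d i = 0"
  using assms by (auto simp: pos_orthant_def topspace_Euclidean_space_iff)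

text \<open>A product of rays and singletons over all of \<open>nat\<close>, so that connectedness
  can be checked factor by factor.\<close>

lemma pos_orthant_eq_PiE:
  "pos_orthant m = PiE UNIV (\<lambda>i. if i < m then {0<..} else {0})"
  by (auto simp: pos_orthant_def topspace_Euclidean_space_iff PiE_UNIV_domain Pi_iff
      dest: spec split: if_split_asm)

lemma pos_orthant_subset: "pos_orthant m \<subseteq> topspace (Euclidean_space m)"
  by (auto simp: pos_orthant_def)

lemma fun_upd_in_pos_orthant:
  "d \<in> pos_orthant m \<Longrightarrow> i < m \<Longrightarrow> 0 < t \<Longrightarrow> d(i := t) \<in> pos_orthant m"
  by (auto simp: pos_orthant_def topspace_Euclidean_space_iff)

lemma connected_pos_orthant: "connected (pos_orthant m)"
proof -
  have "connectedin (powertop_real UNIV) (pos_orthant m)"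
    unfolding pos_orthant_eq_PiE connectedin_PiE by auto
  then show ?thesis by (simp add: euclidean_product_topology)
qed

section \<open>The angle sum and the existence of \<open>b0\<close>\<close>

lemma theta_sum_strict_antimono:
  assumes "d \<in> pos_orthant m" "0 < m" "\<forall>i<m. d i \<le> a" "a < b"
  shows "(\<Sum>i<m. theta (d i) (b / 2)) < (\<Sum>i<m. theta (d i) (a / 2))"
  using assms pos_orthantD(1)[OF assms(1)]
  by (intro sum_strict_mono theta_strict_antimono) auto

text \<open>The entry equal to \<open>b\<close> alone contributes \<pi>; \<open>2 \<le> m\<close>
  leaves at least one further positive angle.\<close>

lemma theta_sum_gt_pi:
  assumes d: "d \<in> pos_orthant m" and m: "2 \<le> m" and b: "\<forall>i<m. d i \<le> b" and j: "j < m" "d j = b"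
  shows "pi < (\<Sum>i<m. theta (d i) (b / 2))"
proof -
  have "0 < b" using pos_orthantD(1)[OF d j(1)] j by simp
  have "card ({..<m} - {j}) = m - 1" using j by simp
  then have "{..<m} - {j} \<noteq> {}" using m by fastforce
  then have "0 < (\<Sum>i\<in>{..<m} - {j}. theta (d i) (b / 2))"
    using pos_orthantD(1)[OF d] b by (intro sum_pos theta_pos) auto
  moreover have "(\<Sum>i<m. theta (d i) (b / 2)) = theta (d j) (b / 2) + (\<Sum>i\<in>{..<m} - {j}. theta (d i) (b / 2))"
    using j by (simp add: sum.remove)
  ultimately show ?thesis using j theta_self[OF \<open>0 < b\<close>] by simp
qed

lemma ex_max_entry:
  fixes d :: "nat \<Rightarrow> real"
  assumes "0 < n"
  obtains j where "j < n" "\<forall>i<n. d i \<le> d j" "Max (d ` {..<n}) = d j"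
proof -
  have "Max (d ` {..<n}) \<in> d ` {..<n}" using assms by (intro Max_in) auto
  then obtain j where j: "j < n" "Max (d ` {..<n}) = d j" by auto
  then have "\<forall>i<n. d i \<le> d j" by (metis Max_ge finite_imageI finite_lessThan imageI lessThan_iff)
  then show ?thesis using that j by blast
qed

lemma b0_equation_iff:
  "b0_equation m d b \<longleftrightarrow> (\<forall>i<m. d i \<le> b) \<and> (\<Sum>i<m. theta (d i) (b / 2)) = pi"
  by (simp add: b0_equation_def)

lemma ex1_b0_equation:
  assumes d: "d \<in> pos_orthant m" and m: "2 \<le> m"
  shows "\<exists>!b. b0_equation m d b"
proof -
  obtain j where j: "j < m" "\<forall>i<m. d i \<le> d j" using ex_max_entry[of m d] m by auto
  let ?G = "\<lambda>b. \<Sum>i<m. theta (d i) (b / 2)"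
  have "((\<lambda>b. theta (d i) (b / 2)) \<longlongrightarrow> 0) at_top" for i
  proof (rule filterlim_compose[OF theta_tendsto_0])
    show "filterlim (\<lambda>b::real. b / 2) at_top at_top"
      by (rule filterlim_at_top_mult_tendsto_pos[OF tendsto_const _ filterlim_ident, of "1/2", simplified])
  qed
  then have "(?G \<longlongrightarrow> (\<Sum>i<m. 0)) at_top" by (intro tendsto_sum)
  then have "eventually (\<lambda>b. ?G b < pi) at_top"
    by (intro order_tendstoD(2)[where y = "\<Sum>i<m. 0"]) auto
  then obtain B where B: "\<And>b. b \<ge> B \<Longrightarrow> ?G b < pi" by (auto simp: eventually_at_top_linorder)
  \<comment> \<open>The interval starts at the maximal entry, the least \<open>b\<close> for which
    all angles are meaningful; \<open>B\<close> may lie below it, hence \<open>max\<close>.\<close>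
  have "continuous_on {d j..max B (d j)} ?G"
    using pos_orthantD(1)[OF d] j by (intro continuous_intros) fastforce+
  moreover have "?G (max B (d j)) \<le> pi" using B[of "max B (d j)"] by simp
  moreover have "pi \<le> ?G (d j)" using theta_sum_gt_pi[OF d m] j by force
  ultimately obtain b where b: "d j \<le> b" "?G b = pi"
    using IVT2'[of ?G "max B (d j)" pi "d j"] by auto
  show ?thesis
  proof (rule ex1I)
    show "b0_equation m d b" using b j by (fastforce simp: b0_equation_iff)
  next
    fix c assume "b0_equation m d c"
    then have c: "d j \<le> c" "?G c = pi" using j by (auto simp: b0_equation_iff)
    have "\<forall>i<m. d i \<le> b" "\<forall>i<m. d i \<le> c" using j b c by fastforce+
    then show "c = b"
      using theta_sum_strict_antimono[OF d, of b c] theta_sum_strict_antimono[OF d, of c b] m b c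
      by (cases c b rule: linorder_cases) auto
  qed
qed

lemma b0_equation_b0:
  assumes "d \<in> pos_orthant m" "2 \<le> m"
  shows "b0_equation m d (b0 m d)"
  unfolding b0_def using theI'[OF ex1_b0_equation[OF assms]] .

lemma b0_eqI:
  assumes "d \<in> pos_orthant m" "2 \<le> m" "b0_equation m d b"
  shows "b0 m d = b"
  using ex1_b0_equation[OF assms(1,2)] b0_equation_b0[OF assms(1,2)] assms(3) by auto

text \<open>An entry equal to \<open>b0 m d\<close> would push the sum above \<pi>, by
  \<open>theta_sum_gt_pi\<close>.\<close>

lemma b0_gt:
  assumes "d \<in> pos_orthant m" "2 \<le> m" "i < m"
  shows "d i < b0 m d"
  using b0_equation_b0[OF assms(1,2)] theta_sum_gt_pi[OF assms(1,2) _ assms(3), of "b0 m d"] assms(3)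
  unfolding b0_equation_iff by fastforce

lemma b0_pos:
  assumes "d \<in> pos_orthant m" "2 \<le> m"
  shows "0 < b0 m d"
  using b0_gt[OF assms, of 0] pos_orthantD(1)[OF assms(1), of 0] assms(2) by simp

text \<open>The sum is strictly decreasing beyond the largest entry and equals \<pi> at
  \<open>b0 m d\<close>. Bounds on the implicitly defined \<open>b0\<close> thus become bounds on an
  explicit sum.\<close>

lemma b0_compare:
  assumes d: "d \<in> pos_orthant m" "2 \<le> m" and a: "\<forall>i<m. d i \<le> a"
  shows less_b0_iff: "a < b0 m d \<longleftrightarrow> pi < (\<Sum>i<m. theta (d i) (a / 2))"
    and b0_less_iff: "b0 m d < a \<longleftrightarrow> (\<Sum>i<m. theta (d i) (a / 2)) < pi"
proof -
  have "(\<Sum>i<m. theta (d i) (b0 m d / 2)) = pi" "\<forall>i<m. d i \<le> b0 m d"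
    using b0_equation_b0[OF d] by (auto simp: b0_equation_iff)
  moreover have "0 < m" using d(2) by simp
  ultimately show "a < b0 m d \<longleftrightarrow> pi < (\<Sum>i<m. theta (d i) (a / 2))"
    "b0 m d < a \<longleftrightarrow> (\<Sum>i<m. theta (d i) (a / 2)) < pi"
    using theta_sum_strict_antimono[OF d(1) _ a, of "b0 m d"]
      theta_sum_strict_antimono[OF d(1), of "b0 m d" a]
    by (cases a "b0 m d" rule: linorder_cases; force)+
qed

section \<open>Symmetry, monotonicity and continuity of \<open>b0\<close>\<close>

lemma symmetric_on_b0:
  assumes "2 \<le> m"
  shows "symmetric_on m (pos_orthant m) (b0 m)"
  unfolding symmetric_on_def
proof (intro allI impI ballI)
  fix p d assume p: "p permutes {..<m}" and d: "d \<in> pos_orthant m"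
  have "(\<forall>i<m. (d \<circ> p) i \<le> b) \<longleftrightarrow> (\<forall>i<m. d i \<le> b)" for b
    using permutes_image[OF p] by (metis (no_types) comp_apply image_iff lessThan_iff)
  moreover have "(\<Sum>i<m. theta ((d \<circ> p) i) (b / 2)) = (\<Sum>i<m. theta (d i) (b / 2))" for b
    using sum.permute[OF p, of "\<lambda>i. theta (d i) (b / 2)"] by (simp add: comp_def)
  ultimately have "b0_equation m (d \<circ> p) = b0_equation m d"
    by (auto simp: b0_equation_iff fun_eq_iff)
  then show "b0 m (d \<circ> p) = b0 m d" by (simp add: b0_def)
qed

text \<open>At the solution for the raised tuple, the angle sum of the original tuple is below
  \<pi>, so the original solution is smaller.\<close>

lemma strict_mono_b0:
  assumes "2 \<le> m"
  shows "strict_mono_in_each_variable_on m (pos_orthant m) (b0 m)"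
  unfolding strict_mono_in_each_variable_on_def
proof (intro allI impI ballI)
  fix i d t assume i: "i < m" and d: "d \<in> pos_orthant m" "d(i := t) \<in> pos_orthant m" and t: "d i < t"
  let ?e = "d(i := t)"
  let ?b = "b0 m ?e"
  have eq: "\<forall>k<m. ?e k \<le> ?b" "(\<Sum>k<m. theta (?e k) (?b / 2)) = pi"
    using b0_equation_b0[OF d(2) assms] by (auto simp: b0_equation_iff)
  have "(\<Sum>k<m. theta (d k) (?b / 2)) < (\<Sum>k<m. theta (?e k) (?b / 2))"
  proof (rule sum_strict_mono_ex1)
    have "theta (d i) (?b / 2) < theta (?e i) (?b / 2)"
      using t eq(1) i pos_orthantD(1)[OF d(1) i] by (intro theta_strict_mono) (simp, simp, metis divide_right_mono zero_le_numeral)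
    then show "\<exists>k\<in>{..<m}. theta (d k) (?b / 2) < theta (?e k) (?b / 2)"
      "\<forall>k\<in>{..<m}. theta (d k) (?b / 2) \<le> theta (?e k) (?b / 2)"
      using i by (auto simp: less_imp_le)
  qed simp
  moreover have "\<forall>k<m. d k \<le> ?b" using eq(1) t by (metis fun_upd_apply less_le_trans less_imp_le)
  ultimately show "b0 m d < ?b" using b0_less_iff[OF d(1) assms] eq(2) by simp
qed

lemma tendsto_coordinate:
  fixes d :: "'a \<Rightarrow> 'b::topological_space"
  shows "((\<lambda>x. x i) \<longlongrightarrow> d i) (at d within S)"
  using continuous_on_product_coordinates[of i]
  by (auto simp: continuous_on_def intro: tendsto_within_subset)

lemma continuous_on_b0:
  assumes m: "2 \<le> m"
  shows "continuous_on (pos_orthant m) (b0 m)"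
  unfolding continuous_on_def
proof (intro ballI order_tendstoI)
  fix d assume d: "d \<in> pos_orthant m"
  let ?F = "at d within pos_orthant m"
  have in_orth: "eventually (\<lambda>x. x \<in> pos_orthant m) ?F"
    by (simp add: eventually_at_topological) blast
  have small: "eventually (\<lambda>x. \<forall>i\<in>{..<m}. x i < a) ?F" if "\<forall>i<m. d i < a" for a
    using that by (intro eventually_ball_finite ballI order_tendstoD(2)[OF tendsto_coordinate]) auto
  have lim: "((\<lambda>x. \<Sum>i<m. theta (x i) (a / 2)) \<longlongrightarrow> (\<Sum>i<m. theta (d i) (a / 2))) ?F"
    if "\<forall>i<m. d i < a" for a
    using that pos_orthantD(1)[OF d] by (intro tendsto_sum tendsto_theta tendsto_coordinate) auto
  show "eventually (\<lambda>x. a < b0 m x) ?F" if a: "a < b0 m d" for a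
  proof -
    obtain j where j: "j < m" "\<forall>i<m. d i \<le> d j" using ex_max_entry[of m d] m by auto
    obtain c where c: "max a (d j) < c" "c < b0 m d"
      using dense[of "max a (d j)" "b0 m d"] a b0_gt[OF d m j(1)] by auto
    have c': "\<forall>i<m. d i < c" using j c by force
    then have "pi < (\<Sum>i<m. theta (d i) (c / 2))" using less_b0_iff[OF d m] c by force
    from in_orth small[OF c'] order_tendstoD(1)[OF lim[OF c'] this] show ?thesis
    proof eventually_elim
      case (elim x)
      then have "c < b0 m x" using less_b0_iff[of x m c] m by (auto intro: less_imp_le)
      then show ?case using c by simp
    qed
  qed
  show "eventually (\<lambda>x. b0 m x < a) ?F" if a: "b0 m d < a" for a
  proof -
    \<comment> \<open>Here \<open>a\<close> exceeds \<open>b0 m d\<close> and hence every entry, so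
      it can be compared directly.\<close>
    have a': "\<forall>i<m. d i < a" using b0_gt[OF d m] a by force
    then have "(\<Sum>i<m. theta (d i) (a / 2)) < pi" using b0_less_iff[OF d m] a by force
    from in_orth small[OF a'] order_tendstoD(2)[OF lim[OF a'] this] show ?thesis
    proof eventually_elim
      case (elim x)
      then show ?case using b0_less_iff[of x m a] m by (auto intro: less_imp_le)
    qed
  qed
qed

subsection \<open>Smoothness\<close>

text \<open>
  Smoothness of \<open>b\<^sub>0\<close> is a bootstrap: the partial derivatives of \<open>b\<^sub>0\<close> are built from the
  coordinates and \<open>b\<^sub>0\<close> itself by the operations below, so the class generated by \<open>b\<^sub>0\<close> is
  closed under partial derivatives.
\<close>

inductive_set smooth_closure ::
  "nat \<Rightarrow> (nat \<Rightarrow> real) set \<Rightarrow> ((nat \<Rightarrow> real) \<Rightarrow> real) \<Rightarrow> ((nat \<Rightarrow> real) \<Rightarrow> real) set"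
  for m S f
where
  gen: "f \<in> smooth_closure m S f"
| const: "(\<lambda>_. c) \<in> smooth_closure m S f"
| coord: "i < m \<Longrightarrow> (\<lambda>d. d i) \<in> smooth_closure m S f"
| add: "g \<in> smooth_closure m S f \<Longrightarrow> h \<in> smooth_closure m S f \<Longrightarrow>
    (\<lambda>d. g d + h d) \<in> smooth_closure m S f"
| mult: "g \<in> smooth_closure m S f \<Longrightarrow> h \<in> smooth_closure m S f \<Longrightarrow>
    (\<lambda>d. g d * h d) \<in> smooth_closure m S f"
| inverse: "g \<in> smooth_closure m S f \<Longrightarrow> (\<And>d. d \<in> S \<Longrightarrow> g d \<noteq> 0) \<Longrightarrow>
    (\<lambda>d. inverse (g d)) \<in> smooth_closure m S f"
| sqrt: "g \<in> smooth_closure m S f \<Longrightarrow> (\<And>d. d \<in> S \<Longrightarrow> 0 < g d) \<Longrightarrow>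
    (\<lambda>d. sqrt (g d)) \<in> smooth_closure m S f"
| sinh: "g \<in> smooth_closure m S f \<Longrightarrow> (\<lambda>d. sinh (g d)) \<in> smooth_closure m S f"
| cosh: "g \<in> smooth_closure m S f \<Longrightarrow> (\<lambda>d. cosh (g d)) \<in> smooth_closure m S f"

lemma smooth_closure_diff:
  assumes "g \<in> smooth_closure m S f" "h \<in> smooth_closure m S f"
  shows "(\<lambda>d. g d - h d) \<in> smooth_closure m S f"
  using smooth_closure.add[OF assms(1) smooth_closure.mult[OF smooth_closure.const[of "-1"] assms(2)]]
  by simp

lemma smooth_closure_divide:
  assumes "g \<in> smooth_closure m S f" "h \<in> smooth_closure m S f" "\<And>d. d \<in> S \<Longrightarrow> h d \<noteq> 0"
  shows "(\<lambda>d. g d / h d) \<in> smooth_closure m S f"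
  using smooth_closure.mult[OF assms(1) smooth_closure.inverse[OF assms(2,3)]]
  by (simp add: divide_inverse)

lemma smooth_closure_power2:
  assumes "g \<in> smooth_closure m S f"
  shows "(\<lambda>d. (g d)\<^sup>2) \<in> smooth_closure m S f"
  using smooth_closure.mult[OF assms assms] by (simp add: power2_eq_square)

lemma smooth_closure_sum:
  assumes "finite I" "\<And>i. i \<in> I \<Longrightarrow> g i \<in> smooth_closure m S f"
  shows "(\<lambda>d. \<Sum>i\<in>I. g i d) \<in> smooth_closure m S f"
  using assms
proof (induction I)
  case (insert i I)
  then have "(\<lambda>d. g i d + (\<Sum>i\<in>I. g i d)) \<in> smooth_closure m S f"
    by (intro smooth_closure.add) auto
  with insert.hyps show ?case by simp
qed (simp add: smooth_closure.const)

lemmas smooth_closure_intros =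
  smooth_closure.intros smooth_closure_diff smooth_closure_divide smooth_closure_power2
  smooth_closure_sum

lemma smooth_closure_continuous_on:
  assumes "continuous_on S f" "g \<in> smooth_closure m S f"
  shows "continuous_on S g"
  using assms(2)
proof induction
  case (coord i)
  show ?case using continuous_on_product_coordinates by (rule continuous_on_subset) simp
qed (use assms(1) in \<open>auto intro!: continuous_intros\<close>)

text \<open>Each differentiation rule builds the derivative from the constituents and their
  derivatives by the same operations; the hypothesis supplies the remaining case, the generator
  \<open>f\<close>.\<close>

lemma smooth_closure_partial:
  assumes f: "\<exists>h\<in>smooth_closure m S f. \<forall>d\<in>S. ((\<lambda>t. f (d(i := t))) has_real_derivative h d) (at (d i))"
    and g: "g \<in> smooth_closure m S f"
  shows "\<exists>h\<in>smooth_closure m S f. \<forall>d\<in>S. ((\<lambda>t. g (d(i := t))) has_real_derivative h d) (at (d i))"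
  using g
proof induction
  case gen
  show ?case using f .
next
  case (const c)
  show ?case by (rule bexI[OF _ smooth_closure.const[of 0]]) simp
next
  case (coord j)
  show ?case
    by (rule bexI[OF _ smooth_closure.const[of "if i = j then 1 else 0"]]) simp
next
  case (add g h)
  then obtain g' h' where mem: "g' \<in> smooth_closure m S f" "h' \<in> smooth_closure m S f"
    and der: "\<forall>d\<in>S. ((\<lambda>t. g (d(i := t))) has_real_derivative g' d) (at (d i))"
    "\<forall>d\<in>S. ((\<lambda>t. h (d(i := t))) has_real_derivative h' d) (at (d i))" by blast
  show ?case
    by (rule bexI[OF _ smooth_closure.add[OF mem]], rule ballI, rule DERIV_add) (rule bspec[OF der(1)] bspec[OF der(2)]; assumption)+
next
  case (mult g h)
  then obtain g' h' where mem: "g' \<in> smooth_closure m S f" "h' \<in> smooth_closure m S f"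
    and der: "\<forall>d\<in>S. ((\<lambda>t. g (d(i := t))) has_real_derivative g' d) (at (d i))"
    "\<forall>d\<in>S. ((\<lambda>t. h (d(i := t))) has_real_derivative h' d) (at (d i))" by blast
  have "(\<lambda>d. g' d * h d + h' d * g d) \<in> smooth_closure m S f"
    using mem mult.hyps by (intro smooth_closure_intros)
  then show ?case
  proof (rule bexI[rotated], intro ballI)
    fix d assume "d \<in> S"
    then show "((\<lambda>t. g (d(i := t)) * h (d(i := t))) has_real_derivative g' d * h d + h' d * g d) (at (d i))"
      using der DERIV_mult[of "\<lambda>t. g (d(i := t))" _ "d i" UNIV "\<lambda>t. h (d(i := t))"] by simp
  qed
next
  case (inverse g)
  then obtain g' where mem: "g' \<in> smooth_closure m S f"
    and der: "\<forall>d\<in>S. ((\<lambda>t. g (d(i := t))) has_real_derivative g' d) (at (d i))" by blast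
  \<comment> \<open>\<open>0 - g' d\<close> stands for the negation, as
    \<open>smooth_closure_intros\<close> offers only differences.\<close>
  have "(\<lambda>d. (0 - g' d) * (inverse (g d))\<^sup>2) \<in> smooth_closure m S f"
    using mem inverse.hyps by (intro smooth_closure_intros)
  then show ?case
  proof (rule bexI[rotated], intro ballI)
    fix d assume d: "d \<in> S"
    then have "g d \<noteq> 0" using inverse.hyps by simp
    with d show "((\<lambda>t. inverse (g (d(i := t)))) has_real_derivative (0 - g' d) * (inverse (g d))\<^sup>2) (at (d i))"
      using der DERIV_inverse'[of "\<lambda>t. g (d(i := t))" _ "d i" UNIV] by (simp add: power2_eq_square mult_ac)
  qed
next
  case (sqrt g)
  then obtain g' where mem: "g' \<in> smooth_closure m S f"
    and der: "\<forall>d\<in>S. ((\<lambda>t. g (d(i := t))) has_real_derivative g' d) (at (d i))" by blast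
  have "sqrt (g d) \<noteq> 0" if "d \<in> S" for d using sqrt.hyps(2)[OF that] by simp
  then have "(\<lambda>d. (inverse (sqrt (g d)) / 2) * g' d) \<in> smooth_closure m S f"
    using mem sqrt.hyps by (intro smooth_closure_intros) auto
  then show ?case
  proof (rule bexI[rotated], intro ballI)
    fix d assume d: "d \<in> S"
    then have "0 < g d" using sqrt.hyps by simp
    with d show "((\<lambda>t. sqrt (g (d(i := t)))) has_real_derivative (inverse (sqrt (g d)) / 2) * g' d) (at (d i))"
      using der DERIV_chain2[OF DERIV_real_sqrt, of "\<lambda>t. g (d(i := t))" "d i"] by simp
  qed
next
  case (sinh g)
  then obtain g' where mem: "g' \<in> smooth_closure m S f"
    and der: "\<forall>d\<in>S. ((\<lambda>t. g (d(i := t))) has_real_derivative g' d) (at (d i))" by blast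
  have "(\<lambda>d. cosh (g d) * g' d) \<in> smooth_closure m S f"
    using mem sinh.hyps by (intro smooth_closure_intros)
  then show ?case
  proof (rule bexI[rotated], intro ballI)
    fix d assume "d \<in> S"
    then show "((\<lambda>t. sinh (g (d(i := t)))) has_real_derivative cosh (g d) * g' d) (at (d i))"
      using der has_field_derivative_sinh[of "\<lambda>t. g (d(i := t))" _ "d i"] by simp
  qed
next
  case (cosh g)
  then obtain g' where mem: "g' \<in> smooth_closure m S f"
    and der: "\<forall>d\<in>S. ((\<lambda>t. g (d(i := t))) has_real_derivative g' d) (at (d i))" by blast
  have "(\<lambda>d. sinh (g d) * g' d) \<in> smooth_closure m S f"
    using mem cosh.hyps by (intro smooth_closure_intros)
  then show ?case
  proof (rule bexI[rotated], intro ballI)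
    fix d assume "d \<in> S"
    then show "((\<lambda>t. cosh (g (d(i := t)))) has_real_derivative sinh (g d) * g' d) (at (d i))"
      using der has_field_derivative_cosh[of "\<lambda>t. g (d(i := t))" _ "d i"] by simp
  qed
qed

text \<open>Only first partials of \<open>f\<close> need inspection. The induction on the order runs
  over all members of the closure at once, because differentiating one member yields
  another.\<close>

lemma smooth_onI:
  assumes "S \<subseteq> topspace (Euclidean_space m)" "continuous_on S f"
    and "\<And>i. i < m \<Longrightarrow>
      \<exists>h\<in>smooth_closure m S f. \<forall>d\<in>S. ((\<lambda>t. f (d(i := t))) has_real_derivative h d) (at (d i))"
  shows "smooth_on m S f"
proof -
  have "C_k_on m S k g" if "g \<in> smooth_closure m S f" for k g
    using that
  proof (induction k arbitrary: g)
    case 0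
    then show ?case
      using smooth_closure_continuous_on[OF assms(2)] subtopology_Euclidean_space[OF assms(1)] by simp
  next
    case (Suc k)
    show ?case
      unfolding C_k_on.simps
    proof (intro allI impI)
      fix i assume "i < m"
      from smooth_closure_partial[OF assms(3)[OF this] Suc.prems]
      obtain h where "h \<in> smooth_closure m S f"
        "\<forall>d\<in>S. ((\<lambda>t. g (d(i := t))) has_real_derivative h d) (at (d i))" by (rule bexE)
      with Suc.IH show "\<exists>h. (\<forall>d\<in>S. ((\<lambda>t. g (d(i := t))) has_real_derivative h d) (at (d i))) \<and> C_k_on m S k h"
        by blast
    qed
  qed
  then show ?thesis by (simp add: smooth_on_def smooth_closure.gen)
qed

section \<open>Partial derivatives of \<open>b0\<close>\<close>

text \<open>The sine of half the angle \<open>theta (d j) (b0 m d / 2)\<close>.\<close>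

definition b0_ratio :: "nat \<Rightarrow> (nat \<Rightarrow> real) \<Rightarrow> nat \<Rightarrow> real" where
  "b0_ratio m d j = sinh (d j / 2) / sinh (b0 m d / 2)"

lemma b0_ratio_bounds:
  assumes "d \<in> pos_orthant m" "2 \<le> m" "j < m"
  shows "0 < b0_ratio m d j" "b0_ratio m d j < 1"
  using pos_orthantD(1)[OF assms(1,3)] b0_gt[OF assms] by (simp_all add: b0_ratio_def)

lemma sum_arcsin_b0_ratio:
  assumes "d \<in> pos_orthant m" "2 \<le> m" "i < m"
  shows "(\<Sum>j\<in>{..<m} - {i}. arcsin (b0_ratio m d j)) = pi / 2 - arcsin (b0_ratio m d i)"
proof -
  have "(\<Sum>j<m. theta (d j) (b0 m d / 2)) = pi"
    using b0_equation_b0[OF assms(1,2)] by (simp add: b0_equation_iff)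
  then have "2 * (\<Sum>j<m. arcsin (b0_ratio m d j)) = pi"
    by (simp add: theta_def b0_ratio_def sum_distrib_left)
  moreover have "(\<Sum>j<m. arcsin (b0_ratio m d j)) =
      arcsin (b0_ratio m d i) + (\<Sum>j\<in>{..<m} - {i}. arcsin (b0_ratio m d j))"
    using assms(3) by (simp add: sum.remove)
  ultimately show ?thesis by simp
qed

text \<open>The result of implicit differentiation. With half-angles
  \<open>\<alpha> j = arcsin (b0_ratio m d j)\<close>, the bracket is the sine of
  \<open>\<alpha> i\<close> plus its cosine times the sum of the other tangents.\<close>

definition b0_partial :: "nat \<Rightarrow> nat \<Rightarrow> (nat \<Rightarrow> real) \<Rightarrow> real" where
  "b0_partial m i d = cosh (d i / 2) / (cosh (b0 m d / 2) *
     (b0_ratio m d i + sqrt (1 - (b0_ratio m d i)\<^sup>2) *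
        (\<Sum>j\<in>{..<m} - {i}. b0_ratio m d j / sqrt (1 - (b0_ratio m d j)\<^sup>2))))"

lemma b0_partial_denominator_pos:
  assumes "d \<in> pos_orthant m" "2 \<le> m" "i < m"
  shows "0 < b0_ratio m d i + sqrt (1 - (b0_ratio m d i)\<^sup>2) *
        (\<Sum>j\<in>{..<m} - {i}. b0_ratio m d j / sqrt (1 - (b0_ratio m d j)\<^sup>2))"
proof -
  have nonneg: "0 \<le> sqrt (1 - (b0_ratio m d j)\<^sup>2)" if "j < m" for j
    using b0_ratio_bounds[OF assms(1,2) that] by (simp add: power_le_one)
  then show ?thesis
    using b0_ratio_bounds(1)[OF assms(1,2)] assms(3)
    by (intro add_pos_nonneg mult_nonneg_nonneg sum_nonneg divide_nonneg_nonneg) (simp_all add: less_imp_le)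
qed

text \<open>
  The equation defining \<open>b\<^sub>0\<close> can be solved for the entry \<open>d i\<close>, which exhibits \<open>b\<^sub>0\<close> as the
  inverse of an explicit function of one variable.
\<close>

lemma b0_has_partial:
  assumes d: "d \<in> pos_orthant m" and m: "2 \<le> m" and i: "i < m"
  shows "((\<lambda>t. b0 m (d(i := t))) has_real_derivative b0_partial m i d) (at (d i))"
proof -
  let ?I = "{..<m} - {i}"
  \<comment> \<open>When \<open>b = b0 m (d(i := t))\<close>, the other half-angles add up to
    \<pi>/2 minus the one of \<open>t\<close>, so
    \<open>cos (A b) = sinh (t / 2) / sinh (b / 2)\<close>. Solving for \<open>t\<close> gives
    \<open>\<tau> b\<close>.\<close>
  define A where "A b = (\<Sum>j\<in>?I. arcsin (sinh (d j / 2) / sinh (b / 2)))" for b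
  define \<tau> where "\<tau> b = 2 * arsinh (sinh (b / 2) * cos (A b))" for b
  let ?b = "b0 m d"
  let ?x = "b0_ratio m d"
  let ?S = "sinh (?b / 2)" and ?C = "cosh (?b / 2)"
  let ?T = "\<Sum>j\<in>?I. ?x j / sqrt (1 - (?x j)\<^sup>2)"
  have A_b0: "A (b0 m (d(i := t))) = pi / 2 - arcsin (b0_ratio m (d(i := t)) i)" if "0 < t" for t
    using sum_arcsin_b0_ratio[OF fun_upd_in_pos_orthant[OF d i that] m i]
    by (simp add: A_def b0_ratio_def)
  have cos_A: "cos (A (b0 m (d(i := t)))) = b0_ratio m (d(i := t)) i" if "0 < t" for t
    using A_b0[OF that] b0_ratio_bounds[OF fun_upd_in_pos_orthant[OF d i that] m i]
    by (simp add: cos_diff)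
  have inv: "\<tau> (b0 m (d(i := t))) = t" if "0 < t" for t
  proof -
    have "sinh (b0 m (d(i := t)) / 2) \<noteq> 0"
      using b0_pos[OF fun_upd_in_pos_orthant[OF d i that] m] by simp
    then have "sinh (b0 m (d(i := t)) / 2) * b0_ratio m (d(i := t)) i = sinh (t / 2)"
      by (simp add: b0_ratio_def)
    then show ?thesis by (simp add: \<tau>_def cos_A[OF that] arsinh_sinh_real)
  qed
  have S: "0 < ?S" using b0_pos[OF d m] by simp
  have pos: "0 < d i" using pos_orthantD(1)[OF d i] .
  have x: "0 < ?x j" "?x j < 1" if "j < m" for j using b0_ratio_bounds[OF d m that] by auto
  have cos_b: "cos (A ?b) = ?x i" using cos_A[OF pos] by simp
  have sin_b: "sin (A ?b) = sqrt (1 - (?x i)\<^sup>2)"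
    using A_b0[OF pos] x[OF i] by (simp add: sin_diff cos_arcsin)
  have S': "((\<lambda>b. sinh (b / 2)) has_real_derivative ?C / 2) (at ?b)"
    using has_field_derivative_sinh[OF DERIV_cdivide[OF DERIV_ident, of 2], of ?b UNIV] by simp
  \<comment> \<open>The factor independent of \<open>j\<close> is kept in front so that it can be
    pulled out of the sum.\<close>
  have "((\<lambda>b. arcsin (sinh (d j / 2) / sinh (b / 2))) has_real_derivative
      - (?C / (2 * ?S)) * (?x j / sqrt (1 - (?x j)\<^sup>2))) (at ?b)" if "j \<in> ?I" for j
  proof -
    have "((\<lambda>b. sinh (d j / 2) / sinh (b / 2)) has_real_derivative - (?C / (2 * ?S)) * ?x j) (at ?b)"
    proof (rule DERIV_cong[OF DERIV_divide[OF DERIV_const S']])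
      show "?S \<noteq> 0" using S by simp
      then show "(0 * ?S - sinh (d j / 2) * (?C / 2)) / (?S * ?S) = - (?C / (2 * ?S)) * ?x j"
        by (simp add: b0_ratio_def mult_ac)
    qed
    moreover have "- 1 < sinh (d j / 2) / ?S" "sinh (d j / 2) / ?S < 1"
      using x[of j] that unfolding b0_ratio_def by auto
    ultimately have "((\<lambda>b. arcsin (sinh (d j / 2) / sinh (b / 2))) has_real_derivative
        inverse (sqrt (1 - (sinh (d j / 2) / ?S)\<^sup>2)) * (- (?C / (2 * ?S)) * ?x j)) (at ?b)"
      by (intro DERIV_chain2[OF DERIV_arcsin])
    then show ?thesis
      unfolding b0_ratio_def by (rule DERIV_cong) (simp add: inverse_eq_divide mult_ac)
  qed
  then have "(A has_real_derivative (\<Sum>j\<in>?I. - (?C / (2 * ?S)) * (?x j / sqrt (1 - (?x j)\<^sup>2)))) (at ?b)"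
    unfolding A_def[abs_def] by (intro DERIV_sum)
  then have A': "(A has_real_derivative - (?C / (2 * ?S)) * ?T) (at ?b)"
    by (simp only: sum_distrib_left)
  have u: "?S * cos (A ?b) = sinh (d i / 2)"
    using S by (simp add: cos_b b0_ratio_def)
  have u': "((\<lambda>b. sinh (b / 2) * cos (A b)) has_real_derivative
      ?C / 2 * (?x i + sqrt (1 - (?x i)\<^sup>2) * ?T)) (at ?b)"
  proof -
    have "((\<lambda>b. sinh (b / 2) * cos (A b)) has_real_derivative
        ?C / 2 * cos (A ?b) + (- sin (A ?b) * (- (?C / (2 * ?S)) * ?T)) * ?S) (at ?b)"
      by (rule DERIV_mult[OF S' DERIV_chain2[OF DERIV_cos A']])
    moreover have "?C / 2 * cos (A ?b) + (- sin (A ?b) * (- (?C / (2 * ?S)) * ?T)) * ?S =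
        ?C / 2 * (?x i + sqrt (1 - (?x i)\<^sup>2) * ?T)"
      using S unfolding cos_b sin_b by (simp add: field_simps)
    ultimately show ?thesis by (rule DERIV_cong)
  qed
  \<comment> \<open>The root from the derivative of \<open>arsinh\<close>, simplified because its
    argument is \<open>sinh (d i / 2)\<close>.\<close>
  have root: "sqrt ((?S * cos (A ?b))\<^sup>2 + 1) = cosh (d i / 2)"
    unfolding u using cosh_square_eq[of "d i / 2"] by (metis cosh_real_nonneg real_sqrt_unique)
  have "2 * (1 / sqrt ((?S * cos (A ?b))\<^sup>2 + 1) * (?C / 2 * (?x i + sqrt (1 - (?x i)\<^sup>2) * ?T))) =
      inverse (b0_partial m i d)"
    unfolding root b0_partial_def by simp
  from DERIV_cong[OF DERIV_cmult[OF DERIV_chain2[OF arsinh_real_has_field_derivative u']] this]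
  have \<tau>': "(\<tau> has_real_derivative inverse (b0_partial m i d)) (at ?b)"
    unfolding \<tau>_def[abs_def] .
  \<comment> \<open>The inverse function rule presupposes continuity of the inverse, here
    \<open>b0\<close> along the \<open>i\<close>-th coordinate.\<close>
  have "continuous_on {0<..} (\<lambda>t. b0 m (d(i := t)))"
  proof (rule continuous_on_compose2[OF continuous_on_b0[OF m]])
    have "continuous_on {0<..} (\<lambda>t. if j = i then t else d j)" for j
      by (cases "j = i") auto
    then show "continuous_on {0<..} (\<lambda>t. d(i := t))"
      by (intro continuous_on_coordinatewise_then_product) (simp add: fun_upd_def)
  qed (use d i fun_upd_in_pos_orthant in auto)
  then have cont: "isCont (\<lambda>t. b0 m (d(i := t))) (d i)"
    using pos by (simp add: continuous_on_eq_continuous_at)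
  have "inverse (b0_partial m i d) \<noteq> 0"
    using b0_partial_denominator_pos[OF assms] by (auto simp: b0_partial_def)
  \<comment> \<open>The inverse relation \<open>inv\<close> holds for positive \<open>t\<close>,
    hence the left end 0; the right end is an arbitrary point above \<open>d i\<close>.\<close>
  with DERIV_inverse_function[where f = \<tau> and g = "\<lambda>t. b0 m (d(i := t))" and x = "d i" and D = "inverse (b0_partial m i d)" and a = 0 and b = "d i + 1"]
  show ?thesis using \<tau>' pos cont inv by simp
qed

text \<open>\<open>b0_partial\<close> is an expression in the coordinates and \<open>b0\<close>
  itself; ratios strictly between 0 and 1 keep the radicands positive and the denominators
  nonzero.\<close>

lemma smooth_on_b0:
  assumes m: "2 \<le> m"
  shows "smooth_on m (pos_orthant m) (b0 m)"
proof (rule smooth_onI)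
  fix i assume i: "i < m"
  have "sinh (b0 m d / 2) \<noteq> 0" if "d \<in> pos_orthant m" for d
    using b0_pos[OF that m] by simp
  then have ratio: "(\<lambda>d. b0_ratio m d j) \<in> smooth_closure m (pos_orthant m) (b0 m)" if "j < m" for j
    unfolding b0_ratio_def
    by (intro smooth_closure_divide smooth_closure.sinh smooth_closure.coord[OF that]
        smooth_closure.gen smooth_closure.const) auto
  have pos: "0 < 1 - (b0_ratio m d j)\<^sup>2" if "d \<in> pos_orthant m" "j < m" for d j
    using b0_ratio_bounds[OF that(1) m that(2)] by (simp add: power_less_one_iff abs_square_less_1)
  have root: "(\<lambda>d. sqrt (1 - (b0_ratio m d j)\<^sup>2)) \<in> smooth_closure m (pos_orthant m) (b0 m)" if "j < m" for j
    by (intro smooth_closure.sqrt smooth_closure_diff smooth_closure_power2 smooth_closure.const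
        ratio[OF that] pos that)
  have root_nz: "sqrt (1 - (b0_ratio m d j)\<^sup>2) \<noteq> 0" if "d \<in> pos_orthant m" "j < m" for d j
    using pos[OF that] by simp
  have "b0_partial m i \<in> smooth_closure m (pos_orthant m) (b0 m)"
    unfolding b0_partial_def[abs_def]
  proof (intro smooth_closure_divide smooth_closure.mult smooth_closure.add smooth_closure_sum
      smooth_closure.cosh ratio root smooth_closure.coord smooth_closure.const smooth_closure.gen)
    fix d assume d: "d \<in> pos_orthant m"
    show "cosh (b0 m d / 2) * (b0_ratio m d i + sqrt (1 - (b0_ratio m d i)\<^sup>2) *
        (\<Sum>j\<in>{..<m} - {i}. b0_ratio m d j / sqrt (1 - (b0_ratio m d j)\<^sup>2))) \<noteq> 0"
      using b0_partial_denominator_pos[OF d m i] cosh_real_pos[of "b0 m d / 2"] by simp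
  qed (use i root_nz in auto)
  then show "\<exists>h\<in>smooth_closure m (pos_orthant m) (b0 m).
      \<forall>d\<in>pos_orthant m. ((\<lambda>t. b0 m (d(i := t))) has_real_derivative h d) (at (d i))"
    using b0_has_partial[OF _ m i] by blast
qed (use continuous_on_b0[OF m] pos_orthant_subset in auto)

subsection \<open>The frontier and its components\<close>

text \<open>
  Compare the mean slopes of \<^const>\<open>sin\<close> on \<open>[0, y]\<close> and \<open>[y, \<pi>/2]\<close>, where \<open>y = arcsin x\<close>;
  \<^const>\<open>sin\<close> is strictly concave there.
\<close>

lemma arcsin_less_linear:
  assumes "0 < x" "x < 1"
  shows "arcsin x < pi / 2 * x"
proof -
  define y where "y = arcsin x"
  have y: "0 < y" "y < pi / 2" "sin y = x"
    using assms arcsin_less_mono[of 0 x] arcsin_less_mono[of x 1] by (simp_all add: y_def)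
  obtain u where u: "0 < u" "u < y" "sin y - sin 0 = (y - 0) * cos u"
    using MVT2[OF y(1), of sin cos] DERIV_sin by blast
  obtain v where v: "y < v" "v < pi / 2" "sin (pi / 2) - sin y = (pi / 2 - y) * cos v"
    using MVT2[OF y(2), of sin cos] DERIV_sin by blast
  have "cos v < cos u" using u v y pi_gt_zero by (intro cos_monotone_0_pi) linarith+
  then have "y * ((pi / 2 - y) * cos v) < (pi / 2 - y) * (y * cos u)"
    using y by simp
  then have "y * (1 - sin y) < (pi / 2 - y) * sin y" using u(3) v(3) by simp
  then show ?thesis using y(3) unfolding y_def by (simp add: algebra_simps)
qed

lemma continuous_on_Max_image:
  fixes f :: "'i \<Rightarrow> 'a::topological_space \<Rightarrow> real"
  assumes "finite I" "I \<noteq> {}" "\<And>i. i \<in> I \<Longrightarrow> continuous_on S (f i)"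
  shows "continuous_on S (\<lambda>x. Max ((\<lambda>i. f i x) ` I))"
  using assms by (induction I rule: finite_ne_induct) (simp_all add: continuous_on_max)

text \<open>Makes \<open>C_set\<close> and \<open>BC_set\<close> a superlevel set and a level set of
  one continuous function.\<close>

definition theta_total :: "nat \<Rightarrow> (nat \<Rightarrow> real) \<Rightarrow> real" where
  "theta_total n d = (\<Sum>i<n. theta (d i) (Max (d ` {..<n}) / 2))"

lemma C_set_iff: "d \<in> C_set n \<longleftrightarrow> d \<in> pos_orthant n \<and> 2 * pi < theta_total n d"
  by (simp add: C_set_def theta_total_def)

lemma BC_set_iff: "d \<in> BC_set n \<longleftrightarrow> d \<in> pos_orthant n \<and> theta_total n d = 2 * pi"
  by (simp add: BC_set_def theta_total_def)

lemma continuous_on_theta_total: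
  assumes "0 < n"
  shows "continuous_on (pos_orthant n) (theta_total n)"
proof -
  have coord: "continuous_on (pos_orthant n) (\<lambda>d. d i)" for i
    using continuous_on_product_coordinates by (rule continuous_on_subset) simp
  moreover have "continuous_on (pos_orthant n) (\<lambda>d. Max (d ` {..<n}))"
    using assms by (intro continuous_on_Max_image coord) auto
  moreover have "d i \<le> Max (d ` {..<n})" if "i < n" for i and d :: "nat \<Rightarrow> real"
    using that by simp
  ultimately show ?thesis
    unfolding theta_total_def[abs_def] using pos_orthantD(1)
    by (intro continuous_on_sum continuous_on_theta continuous_on_divide continuous_on_const) auto
qed

lemma Max_image_eq:
  fixes d :: "nat \<Rightarrow> real"
  assumes "j < n" "\<forall>i<n. d i \<le> d j"
  shows "Max (d ` {..<n}) = d j"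
  using assms by (intro Max_eqI) auto

lemma theta_total_eq:
  assumes "j < n" "\<forall>i<n. d i \<le> d j"
  shows "theta_total n d = (\<Sum>i<n. theta (d i) (d j / 2))"
  by (simp add: theta_total_def Max_image_eq[OF assms])

section \<open>Uniqueness of the maximum and inclusion in \<open>AC_set\<close>\<close>

lemma ex_third_index:
  assumes "3 \<le> (n::nat)"
  obtains k where "k < n" "k \<noteq> i" "k \<noteq> j"
proof -
  have "card {i, j} < card {..<n}" using assms by (simp add: card_insert_if)
  then have "\<not> {..<n} \<subseteq> {i, j}" by (meson card_mono finite.emptyI finite.insertI not_le)
  then show ?thesis using that by blast
qed

text \<open>Two maximal entries would already contribute 2\<pi>, and a third index adds a positive
  angle.\<close>

lemma BC_set_unique_max:
  assumes d: "d \<in> BC_set n" and n: "3 \<le> n" and j: "j < n" "\<forall>i<n. d i \<le> d j"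
    and i: "i < n" "i \<noteq> j"
  shows "d i < d j"
proof (rule ccontr)
  assume "\<not> d i < d j"
  then have eq: "d i = d j" using j i by force
  have pos: "\<And>i. i < n \<Longrightarrow> 0 < d i" using d pos_orthantD(1) by (auto simp: BC_set_iff)
  obtain k where k: "k < n" "k \<noteq> i" "k \<noteq> j" using ex_third_index[OF n] .
  have "(\<Sum>l\<in>{i, j, k}. theta (d l) (d j / 2)) \<le> (\<Sum>l<n. theta (d l) (d j / 2))"
    using pos i j k theta_pos by (intro sum_mono2) (auto intro: less_imp_le)
  also have "\<dots> = 2 * pi" using d theta_total_eq[OF j] by (simp add: BC_set_iff)
  finally show False
    using i k eq theta_self[of "d j"] theta_pos[of "d k" "d j / 2"] pos j by auto
qed

text \<open>For an index other than \<open>j\<close>, the maximal entry and a third one suffice. For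
  \<open>j\<close>, if the ratios to the maximum summed to at most 1,
  \<open>arcsin_less_linear\<close> would force the other angles below \<pi> and the total below
  2\<pi>.\<close>

lemma AC_setI:
  assumes d: "d \<in> pos_orthant n" and n: "3 \<le> n" and total: "2 * pi \<le> theta_total n d"
  shows "d \<in> AC_set n"
proof -
  obtain j where j: "j < n" "\<forall>i<n. d i \<le> d j" using ex_max_entry[of n d] n by auto
  have pos: "0 < d i" if "i < n" for i using pos_orthantD(1)[OF d that] .
  have "sinh (d i / 2) < (\<Sum>k\<in>{..<n} - {i}. sinh (d k / 2))" if i: "i < n" for i
  proof (cases "i = j")
    case False
    obtain k where k: "k < n" "k \<noteq> i" "k \<noteq> j" using ex_third_index[OF n] .
    have "sinh (d i / 2) \<le> sinh (d j / 2)" "0 < sinh (d k / 2)"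
      using i j k pos by simp_all
    then have "sinh (d i / 2) < sinh (d j / 2) + sinh (d k / 2)" by linarith
    also have "\<dots> = (\<Sum>l\<in>{j, k}. sinh (d l / 2))" using k by simp
    also have "\<dots> \<le> (\<Sum>l\<in>{..<n} - {i}. sinh (d l / 2))"
      using False j k pos by (intro sum_mono2) (auto intro: less_imp_le)
    finally show ?thesis .
  next
    case True
    let ?I = "{..<n} - {j}"
    define x where "x k = sinh (d k / 2) / sinh (d j / 2)" for k
    have x_pos: "0 < x k" if "k \<in> ?I" for k
      using sinh_ratio_bounds(1)[of "d k" "d j / 2"] pos j that by (auto simp: x_def)
    have S: "0 < sinh (d j / 2)" using pos[OF j(1)] by simp
    have "1 < (\<Sum>k\<in>?I. x k)"
    proof (rule ccontr)
      assume "\<not> 1 < (\<Sum>k\<in>?I. x k)"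
      then have le: "(\<Sum>k\<in>?I. x k) \<le> 1" by simp
      \<comment> \<open>A second positive ratio keeps each one away from 1, where the bound on
        \<open>arcsin\<close> becomes an equality.\<close>
      have "x k < 1" if k: "k \<in> ?I" for k
      proof -
        obtain l where l: "l < n" "l \<noteq> k" "l \<noteq> j" using ex_third_index[OF n] .
        then have "(\<Sum>k\<in>{k, l}. x k) \<le> (\<Sum>k\<in>?I. x k)"
          using k x_pos by (intro sum_mono2) (auto intro: less_imp_le)
        then show ?thesis using l x_pos[of l] le by auto
      qed
      moreover have nonempty: "?I \<noteq> {}" using ex_third_index[OF n, of j j] by blast
      ultimately have "(\<Sum>k\<in>?I. arcsin (x k)) < (\<Sum>k\<in>?I. pi / 2 * x k)"
        using x_pos nonempty by (intro sum_strict_mono arcsin_less_linear) auto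
      also have "\<dots> \<le> pi / 2"
        using mult_left_mono[OF le, of "pi / 2"] by (simp add: sum_distrib_left)
      finally have "(\<Sum>k\<in>?I. theta (d k) (d j / 2)) < pi"
        by (simp add: theta_def x_def flip: sum_distrib_left)
      moreover have "theta_total n d = theta (d j) (d j / 2) + (\<Sum>k\<in>?I. theta (d k) (d j / 2))"
        using j by (simp add: theta_total_eq[OF j] sum.remove)
      ultimately show False using total theta_self[OF pos[OF j(1)]] by simp
    qed
    then show ?thesis
      using S True by (simp add: x_def field_simps flip: sum_divide_distrib)
  qed
  then show ?thesis using d by (auto simp: AC_set_def)
qed

lemma C_set_subset_AC_set: "3 \<le> n \<Longrightarrow> C_set n \<subseteq> AC_set n"
  using AC_setI by (auto simp: C_set_iff)

lemma BC_set_subset_AC_set: "3 \<le> n \<Longrightarrow> BC_set n \<subseteq> AC_set n"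
  using AC_setI by (auto simp: BC_set_iff)

text \<open>Increasing a non-maximal entry of a point of \<open>BC_set n\<close> leads into \<open>C_set n\<close>.\<close>

lemma BC_set_approximable:
  assumes d: "d \<in> BC_set n" and n: "3 \<le> n" and T: "open T" "d \<in> T"
  shows "\<exists>e\<in>C_set n. e \<in> T"
proof -
  obtain j where j: "j < n" "\<forall>i<n. d i \<le> d j" using ex_max_entry[of n d] n by auto
  obtain i where i: "i < n" "i \<noteq> j" using ex_third_index[OF n, of j j] .
  have orth: "d \<in> pos_orthant n" using d by (simp add: BC_set_iff)
  have less: "d i < d j" using BC_set_unique_max[OF d n j i] .
  have "continuous_on UNIV (\<lambda>t. if k = i then t else d k)" for k by (cases "k = i") auto
  then have "continuous_on UNIV (\<lambda>t. d(i := t))"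
    by (intro continuous_on_coordinatewise_then_product) (simp add: fun_upd_def)
  then have "open ((\<lambda>t. d(i := t)) -` T)" using T(1) by (simp add: open_vimage)
  moreover have "d i \<in> (\<lambda>t. d(i := t)) -` T" using T(2) by simp
  ultimately obtain \<epsilon> where \<epsilon>: "0 < \<epsilon>" "\<And>t. \<bar>t - d i\<bar> < \<epsilon> \<Longrightarrow> d(i := t) \<in> T"
    unfolding open_dist by (auto simp: dist_real_def)
  \<comment> \<open>Capping at \<open>d j\<close> keeps the maximum in place, so only the
    \<open>i\<close>-th angle changes.\<close>
  define t where "t = min (d i + \<epsilon> / 2) (d j)"
  have t: "d i < t" "t \<le> d j" "\<bar>t - d i\<bar> < \<epsilon>" using \<epsilon>(1) less by (auto simp: t_def min_def)
  let ?e = "d(i := t)"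
  have e: "?e \<in> pos_orthant n"
    using fun_upd_in_pos_orthant[OF orth i(1), of t] pos_orthantD(1)[OF orth i(1)] t by simp
  have "theta_total n ?e = (\<Sum>k<n. theta (?e k) (d j / 2))"
    using theta_total_eq[OF j(1), of ?e] j(2) t i by simp
  also have "\<dots> > (\<Sum>k<n. theta (d k) (d j / 2))"
    using theta_strict_mono[OF pos_orthantD(1)[OF orth i(1)] t(1), of "d j / 2"] t i
    by (intro sum_strict_mono_ex1) auto
  finally have "?e \<in> C_set n"
    using e d theta_total_eq[OF j] by (simp add: C_set_iff BC_set_iff)
  then show ?thesis using \<epsilon>(2)[OF t(3)] by blast
qed

text \<open>\<open>C_set n\<close> is open in \<open>AC_set n\<close>, so its frontier is its
  closure minus itself. By continuity the total angle is at least 2\<pi> on the closure; density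
  near \<open>BC_set n\<close> gives the converse.\<close>

lemma BC_set_eq_frontier:
  assumes n: "3 \<le> n"
  shows "BC_set n = (subtopology (Euclidean_space n) (AC_set n)) frontier_of (C_set n)"
proof -
  let ?X = "top_of_set (AC_set n)"
  have AC: "AC_set n \<subseteq> pos_orthant n" by (auto simp: AC_set_def)
  then have X: "subtopology (Euclidean_space n) (AC_set n) = ?X"
    using pos_orthant_subset by (intro subtopology_Euclidean_space) blast
  have cont: "continuous_on (AC_set n) (theta_total n)"
    using continuous_on_subset[OF continuous_on_theta_total AC] n by simp
  have "C_set n = AC_set n \<inter> theta_total n -` {2 * pi<..}"
    using AC C_set_subset_AC_set[OF n] by (auto simp: C_set_iff)
  then have open_C: "openin ?X (C_set n)"
    using continuous_openin_preimage_gen[OF cont open_greaterThan] by metis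
  have closed: "closedin ?X (AC_set n \<inter> theta_total n -` {2 * pi..})"
    using continuous_closedin_preimage[OF cont closed_atLeast] .
  have "C_set n \<subseteq> AC_set n \<inter> theta_total n -` {2 * pi..}"
    using C_set_subset_AC_set[OF n] by (auto simp: C_set_iff)
  from closure_of_minimal[OF this closed]
  have "?X closure_of C_set n - C_set n \<subseteq> BC_set n"
    using AC by (force simp: C_set_iff BC_set_iff)
  moreover have "BC_set n \<subseteq> ?X closure_of C_set n"
  proof
    fix d assume d: "d \<in> BC_set n"
    show "d \<in> ?X closure_of C_set n"
      unfolding in_closure_of
    proof (intro conjI allI impI)
      show "d \<in> topspace ?X" using d BC_set_subset_AC_set[OF n] by auto
    next
      fix U assume "d \<in> U \<and> openin ?X U"
      then obtain T where "open T" "d \<in> T" "U = AC_set n \<inter> T" by (auto simp: openin_open)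
      then show "\<exists>e. e \<in> C_set n \<and> e \<in> U"
        using BC_set_approximable[OF d n] C_set_subset_AC_set[OF n] by blast
    qed
  qed
  moreover have "BC_set n \<inter> C_set n = {}" by (auto simp: C_set_iff BC_set_iff)
  ultimately show ?thesis
    unfolding X frontier_of_def interior_of_openin[OF open_C] by blast
qed

section \<open>Cyclic shifts and the orbit of the graph\<close>

lemma bij_betw_add_mod:
  assumes "0 < (n::nat)"
  shows "bij_betw (\<lambda>i. (i + k) mod n) {..<n} {..<n}"
proof -
  have "inj_on (\<lambda>i. (i + k) mod n) {..<n}"
  proof (rule linorder_inj_onI')
    fix i j assume ij: "i \<in> {..<n}" "j \<in> {..<n}" "i < j"
    then have "\<not> n dvd j - i" by (auto dest: dvd_imp_le)
    then show "(i + k) mod n \<noteq> (j + k) mod n"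
      using ij mod_eq_dvd_iff_nat[of "i + k" "j + k" n] by auto
  qed
  then show ?thesis
    using assms by (intro bij_betw_imageI endo_inj_surj) auto
qed

lemma cyclic_shift_in_pos_orthant:
  "d \<in> pos_orthant n \<Longrightarrow> cyclic_shift n k d \<in> pos_orthant n"
  by (auto simp: pos_orthant_def topspace_Euclidean_space_iff cyclic_shift_def)

text \<open>Rotation permutes the entries, which changes neither the maximum nor the sum.\<close>

lemma theta_total_cyclic_shift:
  assumes "0 < n"
  shows "theta_total n (cyclic_shift n k d) = theta_total n d"
proof -
  note bij = bij_betw_add_mod[OF assms, of k]
  have "cyclic_shift n k d ` {..<n} = d ` (\<lambda>i. (i + k) mod n) ` {..<n}"
    by (auto simp: cyclic_shift_def image_image)
  then have "cyclic_shift n k d ` {..<n} = d ` {..<n}"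
    using bij by (simp add: bij_betw_def)
  then show ?thesis
    using sum.reindex_bij_betw[OF bij, of "\<lambda>i. theta (d i) (Max (d ` {..<n}) / 2)"]
    by (simp add: theta_total_def cyclic_shift_def)
qed

lemma cyclic_shift_in_BC_set:
  "0 < n \<Longrightarrow> d \<in> BC_set n \<Longrightarrow> cyclic_shift n k d \<in> BC_set n"
  by (simp add: BC_set_iff cyclic_shift_in_pos_orthant theta_total_cyclic_shift)

lemma cyclic_shift_cyclic_shift:
  assumes "d \<in> topspace (Euclidean_space n)" "(k + l) mod n = 0"
  shows "cyclic_shift n k (cyclic_shift n l d) = d"
proof
  fix i
  have "((i + k) mod n + l) mod n = i" if "i < n"
  proof -
    have "((i + k) mod n + l) mod n = (i + (k + l) mod n) mod n" by (simp add: mod_simps add.assoc)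
    then show ?thesis using that assms(2) by simp
  qed
  then show "cyclic_shift n k (cyclic_shift n l d) i = d i"
    using assms(1) by (simp add: cyclic_shift_def topspace_Euclidean_space_iff)
qed

text \<open>For \<open>n \<ge> 3\<close> and \<open>j < n\<close> these pieces turn out to be the
  connected components of \<open>BC_set n\<close>.\<close>

definition max_at :: "nat \<Rightarrow> nat \<Rightarrow> (nat \<Rightarrow> real) set" where
  "max_at n j = {d \<in> BC_set n. \<forall>i<n. d i \<le> d j}"

text \<open>Splitting off the angle \<pi> at index 0 turns total angle 2\<pi> into the equation of
  \<open>b0\<close> for the tail; its domain condition is the maximality of entry 0.\<close>

lemma graph_b0_eq_max_at:
  assumes m: "2 \<le> m"
  shows "graph_b0 m = max_at (Suc m) 0"
proof (intro equalityI subsetI)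
  fix e assume "e \<in> graph_b0 m"
  then obtain d where d: "d \<in> pos_orthant m" and e: "e = case_nat (b0 m d) d"
    by (auto simp: graph_b0_def)
  have max: "\<forall>i<Suc m. e i \<le> e 0"
    using b0_gt[OF d m] by (auto simp: e split: nat.split intro: less_imp_le)
  have "e \<in> pos_orthant (Suc m)"
    using d b0_pos[OF d m]
    by (auto simp: e pos_orthant_def topspace_Euclidean_space_iff split: nat.split)
  moreover have "theta_total (Suc m) e = 2 * pi"
    using b0_equation_b0[OF d m] theta_self[OF b0_pos[OF d m]] theta_total_eq[OF _ max]
    by (simp add: e b0_equation_iff sum.lessThan_Suc_shift del: sum.lessThan_Suc)
  ultimately show "e \<in> max_at (Suc m) 0"
    using max by (simp add: max_at_def BC_set_iff)
next
  fix e assume "e \<in> max_at (Suc m) 0"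
  then have e: "e \<in> pos_orthant (Suc m)" "theta_total (Suc m) e = 2 * pi" "\<forall>i<Suc m. e i \<le> e 0"
    by (auto simp: max_at_def BC_set_iff)
  define d where "d i = e (Suc i)" for i
  have d: "d \<in> pos_orthant m"
    using e(1) by (auto simp: d_def pos_orthant_def topspace_Euclidean_space_iff)
  have "0 < e 0" using pos_orthantD(1)[OF e(1)] by simp
  then have "b0_equation m d (e 0)"
    using e(2,3) theta_total_eq[OF _ e(3)] theta_self[of "e 0"]
    by (simp add: d_def b0_equation_iff sum.lessThan_Suc_shift del: sum.lessThan_Suc)
  then have "b0 m d = e 0" by (rule b0_eqI[OF d m])
  then have "e = case_nat (b0 m d) d" by (auto simp: d_def fun_eq_iff split: nat.split)
  then show "e \<in> graph_b0 m" using d by (auto simp: graph_b0_def)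
qed

lemma cyclic_shift_max_at:
  assumes "k < n" "j < n" "(j + k) mod n = l"
  shows "cyclic_shift n k ` max_at n l \<subseteq> max_at n j"
proof (clarsimp simp: max_at_def)
  fix d assume "d \<in> BC_set n" "\<forall>i<n. d i \<le> d l"
  then show "cyclic_shift n k d \<in> BC_set n \<and> (\<forall>i<n. cyclic_shift n k d i \<le> cyclic_shift n k d j)"
    using assms cyclic_shift_in_BC_set[of n d k] by (auto simp: cyclic_shift_def)
qed

text \<open>A shift by \<open>k\<close> reads index \<open>i + k\<close>, so it carries the maximum
  from 0 to \<open>-k\<close> modulo \<open>n\<close>. The outer \<open>mod\<close> handles
  \<open>j = 0\<close> and keeps the shift below \<open>n\<close>, as in
  \<open>cyclic_orbit\<close>.\<close>

lemma max_at_eq_image: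
  assumes "j < n"
  shows "max_at n j = cyclic_shift n ((n - j) mod n) ` max_at n 0"
proof
  have inv: "(j + (n - j) mod n) mod n = 0" using assms by (simp add: mod_add_right_eq)
  then show "cyclic_shift n ((n - j) mod n) ` max_at n 0 \<subseteq> max_at n j"
    using assms by (intro cyclic_shift_max_at) auto
  show "max_at n j \<subseteq> cyclic_shift n ((n - j) mod n) ` max_at n 0"
  proof
    fix d assume d: "d \<in> max_at n j"
    then have "d \<in> topspace (Euclidean_space n)"
      using pos_orthant_subset by (auto simp: max_at_def BC_set_iff)
    then have "d = cyclic_shift n ((n - j) mod n) (cyclic_shift n j d)"
      using inv by (subst cyclic_shift_cyclic_shift) (simp_all add: add.commute)
    moreover have "cyclic_shift n j d \<in> max_at n 0"
      using d assms cyclic_shift_max_at[of j n 0 j] by auto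
    ultimately show "d \<in> cyclic_shift n ((n - j) mod n) ` max_at n 0" by blast
  qed
qed

lemma BC_set_eq_Union_max_at:
  assumes "0 < n"
  shows "BC_set n = (\<Union>j<n. max_at n j)"
proof
  show "BC_set n \<subseteq> (\<Union>j<n. max_at n j)"
  proof
    fix d assume "d \<in> BC_set n"
    moreover obtain j where "j < n" "\<forall>i<n. d i \<le> d j" using ex_max_entry[OF assms, of d] .
    ultimately show "d \<in> (\<Union>j<n. max_at n j)" by (auto simp: max_at_def)
  qed
qed (auto simp: max_at_def)

lemma BC_set_eq_orbit:
  assumes m: "2 \<le> m"
  shows "BC_set (Suc m) = cyclic_orbit (Suc m) (graph_b0 m)"
proof
  show "BC_set (Suc m) \<subseteq> cyclic_orbit (Suc m) (graph_b0 m)"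
    unfolding BC_set_eq_Union_max_at[OF zero_less_Suc] cyclic_orbit_def graph_b0_eq_max_at[OF m]
  proof (rule UN_least)
    fix j assume "j \<in> {..<Suc m}"
    then show "max_at (Suc m) j \<subseteq> (\<Union>k<Suc m. cyclic_shift (Suc m) k ` max_at (Suc m) 0)"
      by (subst max_at_eq_image) (auto intro!: bexI[of _ "(Suc m - j) mod Suc m"])
  qed
  show "cyclic_orbit (Suc m) (graph_b0 m) \<subseteq> BC_set (Suc m)"
    unfolding cyclic_orbit_def graph_b0_eq_max_at[OF m]
    using cyclic_shift_in_BC_set[of "Suc m"] by (auto simp: max_at_def)
qed

section \<open>Connected components of \<open>BC_set\<close>\<close>

text \<open>The piece is the continuous image of the connected orthant under the graph map followed
  by a rotation.\<close>

lemma connected_max_at: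
  assumes m: "2 \<le> m" and j: "j < Suc m"
  shows "connected (max_at (Suc m) j)"
proof -
  let ?k = "(Suc m - j) mod Suc m"
  let ?\<phi> = "\<lambda>d. cyclic_shift (Suc m) ?k (case_nat (b0 m d) d)"
  have coord: "continuous_on (pos_orthant m) (\<lambda>d. d i)" for i
    using continuous_on_product_coordinates by (rule continuous_on_subset) simp
  have "continuous_on (pos_orthant m) (\<lambda>d. case_nat (b0 m d) d l)" for l
    by (cases l) (simp_all add: continuous_on_b0[OF m] coord)
  then have "continuous_on (pos_orthant m) (\<lambda>d. ?\<phi> d i)" for i
    unfolding cyclic_shift_def by (cases "i < Suc m") simp_all
  then have "continuous_on (pos_orthant m) ?\<phi>"
    by (rule continuous_on_coordinatewise_then_product)
  from connected_continuous_image[OF this connected_pos_orthant]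
  show ?thesis
    unfolding max_at_eq_image[OF j] graph_b0_eq_max_at[OF m, symmetric]
    by (simp add: graph_b0_def image_image Setcompr_eq_image)
qed

lemma max_at_nonempty:
  assumes m: "2 \<le> m" and j: "j < Suc m"
  shows "max_at (Suc m) j \<noteq> {}"
proof -
  have "(\<lambda>i. if i < m then 1 else 0) \<in> pos_orthant m"
    by (simp add: pos_orthant_def topspace_Euclidean_space_iff)
  then show ?thesis
    unfolding max_at_eq_image[OF j] graph_b0_eq_max_at[OF m, symmetric] graph_b0_def by blast
qed

lemma max_at_disjoint:
  assumes "3 \<le> n" "i < n" "j < n" "d \<in> max_at n i" "d \<in> max_at n j"
  shows "i = j"
  using assms BC_set_unique_max[of d n j i] by (force simp: max_at_def)

lemma closedin_max_at: "closedin (top_of_set (BC_set n)) (max_at n j)"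
proof -
  have "closed {d :: nat \<Rightarrow> real. d i \<le> d j}" for i
    by (intro closed_Collect_le continuous_on_product_coordinates)
  then have "closed (\<Inter>i<n. {d :: nat \<Rightarrow> real. d i \<le> d j})" by auto
  moreover have "max_at n j = BC_set n \<inter> (\<Inter>i<n. {d. d i \<le> d j})"
    by (auto simp: max_at_def)
  ultimately show ?thesis by (simp add: closedin_closed_Int)
qed

text \<open>Uniqueness of the maximum allows the defining weak inequalities to be replaced by strict
  ones.\<close>

lemma openin_max_at:
  assumes n: "3 \<le> n" and j: "j < n"
  shows "openin (top_of_set (BC_set n)) (max_at n j)"
proof -
  have "open {d :: nat \<Rightarrow> real. d i < d j}" for i
    by (intro open_Collect_less continuous_on_product_coordinates)
  then have "open (\<Inter>i\<in>{..<n} - {j}. {d :: nat \<Rightarrow> real. d i < d j})" by auto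
  moreover have "max_at n j = BC_set n \<inter> (\<Inter>i\<in>{..<n} - {j}. {d. d i < d j})"
  proof (intro equalityI subsetI)
    fix d assume "d \<in> max_at n j"
    then show "d \<in> BC_set n \<inter> (\<Inter>i\<in>{..<n} - {j}. {d. d i < d j})"
      using BC_set_unique_max[OF _ n j] by (auto simp: max_at_def)
  next
    fix d assume d: "d \<in> BC_set n \<inter> (\<Inter>i\<in>{..<n} - {j}. {d. d i < d j})"
    then have "d i \<le> d j" if "i < n" for i using that by (cases "i = j") (auto intro: less_imp_le)
    then show "d \<in> max_at n j" using d by (simp add: max_at_def)
  qed
  ultimately show ?thesis by (simp add: openin_open_Int)
qed

text \<open>A component meeting a clopen \<open>B\<close> lies inside it, and a connected
  \<open>B\<close> meeting a component lies inside that component; so the two coincide.\<close>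

lemma connected_components_of_clopen_cover:
  assumes "\<Union>\<B> = topspace X"
    and B: "\<And>B. B \<in> \<B> \<Longrightarrow> connectedin X B \<and> openin X B \<and> closedin X B \<and> B \<noteq> {}"
  shows "connected_components_of X = \<B>"
proof -
  have eq: "C = B" if "C \<in> connected_components_of X" "B \<in> \<B>" "\<not> disjnt C B" for B C
    using that B[OF that(2)] connected_components_of_maximal[of C X B]
      connectedin_clopen_cases[of X C B] connectedin_connected_components_of[of C X] by blast
  show ?thesis
  proof (intro equalityI subsetI)
    fix C assume C: "C \<in> connected_components_of X"
    then obtain x where x: "x \<in> C" using nonempty_connected_components_of[OF C] by auto
    then obtain B where "B \<in> \<B>" "x \<in> B" using connected_components_of_subset[OF C] assms(1) by blast
    then show "C \<in> \<B>" using eq[OF C] x by (auto simp: disjnt_iff)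
  next
    fix B assume B': "B \<in> \<B>"
    then obtain x where x: "x \<in> B" using B by blast
    then have "x \<in> \<Union>(connected_components_of X)"
      using B' assms(1) by (auto simp: Union_connected_components_of)
    then obtain C where "C \<in> connected_components_of X" "x \<in> C" by blast
    then show "B \<in> connected_components_of X" using eq[of C B] B' x by (auto simp: disjnt_iff)
  qed
qed

lemma card_connected_components_BC_set:
  assumes m: "2 \<le> m"
  shows "card (connected_components_of (subtopology (Euclidean_space (Suc m)) (BC_set (Suc m)))) = Suc m"
proof -
  let ?n = "Suc m"
  let ?X = "top_of_set (BC_set ?n)"
  have n: "3 \<le> ?n" using m by simp
  have "BC_set ?n \<subseteq> topspace (Euclidean_space ?n)"
    using pos_orthant_subset[of ?n] by (auto simp: BC_set_iff)
  then have X: "subtopology (Euclidean_space ?n) (BC_set ?n) = ?X"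
    by (rule subtopology_Euclidean_space)
  have "connected_components_of ?X = max_at ?n ` {..<?n}"
  proof (rule connected_components_of_clopen_cover)
    show "\<Union>(max_at ?n ` {..<?n}) = topspace ?X"
      using BC_set_eq_Union_max_at[of ?n] by simp
    fix B assume "B \<in> max_at ?n ` {..<?n}"
    then obtain j where j: "j < ?n" "B = max_at ?n j" by auto
    have "B \<subseteq> BC_set ?n" by (auto simp: j max_at_def)
    then show "connectedin ?X B \<and> openin ?X B \<and> closedin ?X B \<and> B \<noteq> {}"
      using connected_max_at[OF m j(1)] openin_max_at[OF n j(1)] closedin_max_at[of ?n j]
        max_at_nonempty[OF m j(1)]
      by (simp add: j connectedin_subtopology)
  qed
  \<comment> \<open>Nonempty disjoint pieces are distinct, so the count equals the number of
    indices.\<close>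
  moreover have "inj_on (max_at ?n) {..<?n}"
  proof (rule inj_onI)
    fix i j assume "i \<in> {..<?n}" "j \<in> {..<?n}" "max_at ?n i = max_at ?n j"
    then show "i = j"
      using max_at_nonempty[OF m, of j] max_at_disjoint[OF n, of i j] by auto
  qed
  ultimately show ?thesis by (simp add: X card_image)
qed

theorem proposition1p12:
  fixes n :: nat
  assumes "n \<ge> 3"
  shows "(\<forall>d \<in> pos_orthant (n - 1). (\<exists>!b. b0_equation (n - 1) d b) \<and>
            b0_equation (n - 1) d (b0 (n - 1) d))
    \<and> BC_set n = (subtopology (Euclidean_space n) (AC_set n)) frontier_of (C_set n)
    \<and> BC_set n = cyclic_orbit n (graph_b0 (n - 1))
    \<and> symmetric_on (n - 1) (pos_orthant (n - 1)) (b0 (n - 1))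
    \<and> smooth_on (n - 1) (pos_orthant (n - 1)) (b0 (n - 1))
    \<and> strict_mono_in_each_variable_on (n - 1) (pos_orthant (n - 1)) (b0 (n - 1))
    \<and> (\<forall>d \<in> pos_orthant (n - 1). b0 (n - 1) d > Max (d ` {..<n - 1}))
    \<and> card (connected_components_of (subtopology (Euclidean_space n) (BC_set n))) = n"
proof -
  define m where "m = n - 1"
  have n: "n = Suc m" and m: "2 \<le> m" using assms by (simp_all add: m_def)
  have "Max (d ` {..<m}) < b0 m d" if "d \<in> pos_orthant m" for d
    using ex_max_entry[of m d] b0_gt[OF that m] m by (metis less_le_trans zero_less_numeral)
  then show ?thesis
    using ex1_b0_equation[OF _ m] b0_equation_b0[OF _ m] BC_set_eq_frontier[OF assms]
      BC_set_eq_orbit[OF m] symmetric_on_b0[OF m] smooth_on_b0[OF m] strict_mono_b0[OF m]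
      card_connected_components_BC_set[OF m]
    unfolding n diff_Suc_1 by (intro conjI ballI) assumption+
qed

end
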